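(* Let $p\ge 1$ be an integer and suppose that $f:[0,1]\to\mathbb{R}$ is $p+1$ times differentiable with $\|f^{(p+1)}\|_{L^\infty([0,1])}\le C$. Let $m\geq 1$ be an integer. If $N>p$ is an integer, then $$E_{m,N}[f]\le\frac{4C}{\pi}\,\frac{2^{-m}}{p(N-p)^p}.$$ If $T$ is the quantized tensor representation of $f$ on $\mathcal{D}_K$ for some integer $K>m$, then it follows that, for every $\varepsilon>0$, $$r_m^{(\varepsilon,\infty)}[T]\le 1+p+\left\lceil\left(\frac{4C}{\pi}\,\frac{2^{-m}}{p\,\varepsilon}\right)^{1/p}\right\rceil.$$
   Context: Dyadic grid: $\mathcal{D}_K=(2^{-K}\mathbb{Z})\cap[0,1)$; each $x\in\mathcal{D}_K$ is written uniquely as $x=\sum_{k=1}^K 2^{-k}\sigma_k$ with $\sigma_k\in\{0,1\}$. The quantized tensor representation of $f:[0,1]\to\mathbb{R}$ on $\mathcal{D}_K$ is the tensor $T:\{0,1\}^K\to\mathbb{R}$, $T(\sigma_1,\dots,\sigma_K)=f\left(\sum_{k=1}^K 2^{-k}\sigma_k\right)$. Tensor norm: $\|S\|_\infty=\max_{\sigma\in\{0,1\}^K}|S(\sigma)|$. The $(\varepsilon,\infty)$ rank of the $m$-th unfolding matrix, denoted $r_m^{(\varepsilon,\infty)}[T]$, is the smallest $r$ such that $\left\|T-\sum_{\alpha=0}^{r-1}T_L^\alpha\otimes T_R^\alpha\right\|_\infty\le\varepsilon$ for some tensors $T_L^\alpha:\{0,1\}^m\to\mathbb{R}$ and $T_R^\alpha:\{0,1\}^{K-m}\to\mathbb{R}$,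 where $(T_L\otimes T_R)(\sigma_1,\dots,\sigma_K)=T_L(\sigma_1,\dots,\sigma_m)\,T_R(\sigma_{m+1},\dots,\sigma_K)$. Chebyshev-Lobatto grid on $[0,1]$: $c_N^\alpha=\frac{\cos(\pi\alpha/N)+1}{2}$, $\alpha=0,\dots,N$; $P_N^\alpha$ is the Lagrange basis polynomial of degree $N$ with $P_N^\alpha(c_N^\beta)=\delta^{\alpha\beta}$. Interpolation error: $E_{m,N}[f]=\max_{u\in[0,1-2^{-m}],\,v\in[0,1]}\left|f(u+2^{-m}v)-\sum_{\alpha=0}^N f(u+2^{-m}c_N^\alpha)P_N^\alpha(v)\right|$. *)

theory Defs
  imports
    "HOL-Probability.Essential_Supremum"
    "HOL-Computational_Algebra.Polynomial"
begin

text \<open>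
  A function on the unit interval is a function of type \<open>real \<Rightarrow> real\<close> of which only the
  values on \<open>{0..1}\<close> matter. Derivatives are taken within \<open>{0..1}\<close>, hence are one-sided at
  the two end points.
\<close>

primrec unit_deriv :: "nat \<Rightarrow> (real \<Rightarrow> real) \<Rightarrow> real \<Rightarrow> real" where
  "unit_deriv 0 f = f"
| "unit_deriv (Suc k) f = (\<lambda>x. vector_derivative (unit_deriv k f) (at x within {0..1}))"

definition times_differentiable :: "nat \<Rightarrow> (real \<Rightarrow> real) \<Rightarrow> bool" where
  "times_differentiable n f \<longleftrightarrow> (\<forall>k<n. unit_deriv k f differentiable_on {0..1})"

definition Linf_norm :: "(real \<Rightarrow> real) \<Rightarrow> ereal" where
  "Linf_norm g = esssup (lebesgue_on {0..1}) (\<lambda>x. ereal \<bar>g x\<bar>)"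

definition cheb_node :: "nat \<Rightarrow> nat \<Rightarrow> real" where
  "cheb_node N \<alpha> = (cos (pi * real \<alpha> / real N) + 1) / 2"

definition lagrange_basis :: "nat \<Rightarrow> nat \<Rightarrow> real poly" where
  "lagrange_basis N \<alpha> =
     (\<Prod>\<beta>\<in>{0..N} - {\<alpha>}. smult (1 / (cheb_node N \<alpha> - cheb_node N \<beta>)) [:- cheb_node N \<beta>, 1:])"

lemma cheb_node_eq_iff:
  assumes "N \<ge> 1" "\<alpha> \<le> N" "\<beta> \<le> N"
  shows "cheb_node N \<alpha> = cheb_node N \<beta> \<longleftrightarrow> \<alpha> = \<beta>"
proof
  assume "cheb_node N \<alpha> = cheb_node N \<beta>"
  then have "cos (pi * real \<alpha> / real N) = cos (pi * real \<beta> / real N)"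
    by (simp add: cheb_node_def)
  moreover have "0 \<le> pi * real \<gamma> / real N \<and> pi * real \<gamma> / real N \<le> pi" if "\<gamma> \<le> N" for \<gamma>
    using that assms(1) by (simp add: field_simps)
  ultimately have "pi * real \<alpha> / real N = pi * real \<beta> / real N"
    using assms by (meson cos_inj_pi)
  then show "\<alpha> = \<beta>"
    using assms(1) by simp
qed simp

lemma poly_lagrange_basis_node:
  assumes "N \<ge> 1" "\<alpha> \<le> N" "\<beta> \<le> N"
  shows "poly (lagrange_basis N \<alpha>) (cheb_node N \<beta>) = (if \<alpha> = \<beta> then 1 else 0)"
proof (cases "\<alpha> = \<beta>")
  case True
  have "poly (lagrange_basis N \<alpha>) (cheb_node N \<alpha>) =
      (\<Prod>\<gamma>\<in>{0..N} - {\<alpha>}. 1 / (cheb_node N \<alpha> - cheb_node N \<gamma>) * (cheb_node N \<alpha> - cheb_node N \<gamma>))"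
    unfolding lagrange_basis_def poly_prod by (intro prod.cong) (simp_all flip: diff_divide_distrib)
  also have "\<dots> = (\<Prod>\<gamma>\<in>{0..N} - {\<alpha>}. 1)"
    using cheb_node_eq_iff[OF assms(1,2)] by (intro prod.cong) auto
  finally show ?thesis
    using True by simp
next
  case False
  then show ?thesis
    using assms(3) by (auto simp: lagrange_basis_def poly_prod prod_zero_iff)
qed

lemma degree_lagrange_basis:
  assumes "N \<ge> 1" "\<alpha> \<le> N"
  shows "degree (lagrange_basis N \<alpha>) = N"
proof -
  have ne: "cheb_node N \<alpha> \<noteq> cheb_node N \<beta>" if "\<beta> \<in> {0..N} - {\<alpha>}" for \<beta>
    using that cheb_node_eq_iff[OF assms, of \<beta>] by auto
  have "degree (lagrange_basis N \<alpha>) =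
      (\<Sum>\<beta>\<in>{0..N} - {\<alpha>}. degree (smult (1 / (cheb_node N \<alpha> - cheb_node N \<beta>)) [:- cheb_node N \<beta>, 1:]))"
    unfolding lagrange_basis_def using ne by (intro degree_prod_eq_sum_degree) auto
  also have "\<dots> = (\<Sum>\<beta>\<in>{0..N} - {\<alpha>}. 1)"
    using ne by (intro sum.cong) auto
  also have "\<dots> = N"
    using assms by simp
  finally show ?thesis .
qed

text \<open>
  The maximum over a compact set, written as a supremum; the two agree because the function
  is continuous in \<open>(u, v)\<close> whenever \<open>f\<close> is continuous on \<open>{0..1}\<close>.
\<close>

definition interp_error :: "nat \<Rightarrow> nat \<Rightarrow> (real \<Rightarrow> real) \<Rightarrow> real" where
  "interp_error m N f =
     (SUP (u, v) \<in> {0..1 - 1 / 2 ^ m} \<times> {0..1}.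
        \<bar>f (u + 1 / 2 ^ m * v)
          - (\<Sum>\<alpha>=0..N. f (u + 1 / 2 ^ m * cheb_node N \<alpha>) * poly (lagrange_basis N \<alpha>) v)\<bar>)"

text \<open>
  A multi-index in \<open>{0,1}\<^sup>K\<close> is a list of length \<open>K\<close>, its entry \<open>\<sigma>\<^sub>k\<close> being \<open>\<sigma> ! (k - 1)\<close>;
  a tensor on \<open>{0,1}\<^sup>K\<close> is a function of which only the values on \<open>bits K\<close> matter.
\<close>

type_synonym tensor = "nat list \<Rightarrow> real"

definition bits :: "nat \<Rightarrow> nat list set" where
  "bits K = {\<sigma>. set \<sigma> \<subseteq> {0, 1} \<and> length \<sigma> = K}"

lemma finite_bits: "finite (bits K)"
  unfolding bits_def by (rule finite_lists_length_eq) simp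

lemma bits_nonempty: "bits K \<noteq> {}"
proof -
  have "replicate K 0 \<in> bits K"
    by (auto simp: bits_def)
  then show ?thesis by blast
qed

definition quantized_tensor :: "nat \<Rightarrow> (real \<Rightarrow> real) \<Rightarrow> tensor" where
  "quantized_tensor K f = (\<lambda>\<sigma>. f (\<Sum>k=1..K. 1 / 2 ^ k * real (\<sigma> ! (k - 1))))"

definition tensor_norm :: "nat \<Rightarrow> tensor \<Rightarrow> real" where
  "tensor_norm K S = Max ((\<lambda>\<sigma>. \<bar>S \<sigma>\<bar>) ` bits K)"

definition tensor_prod :: "nat \<Rightarrow> tensor \<Rightarrow> tensor \<Rightarrow> tensor" where
  "tensor_prod m TL TR = (\<lambda>\<sigma>. TL (take m \<sigma>) * TR (drop m \<sigma>))"

definition eps_rank :: "nat \<Rightarrow> nat \<Rightarrow> real \<Rightarrow> tensor \<Rightarrow> nat" where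
  "eps_rank K m \<epsilon> T =
     (LEAST r. \<exists>TL TR :: nat \<Rightarrow> tensor.
        tensor_norm K (\<lambda>\<sigma>. T \<sigma> - (\<Sum>\<alpha><r. tensor_prod m (TL \<alpha>) (TR \<alpha>) \<sigma>)) \<le> \<epsilon>)"

end

theory Submission
  imports Defs
begin

text \<open>
  Fix \<open>u\<close>, put \<open>h = 1 / 2 ^ m\<close> and consider \<open>g v = f (u + h * v)\<close> on \<open>{0..1}\<close>. Its derivative of
  order \<open>p + 1\<close> is bounded by \<open>h ^ (p + 1) * C\<close> everywhere, not only almost everywhere
  (\<open>abs_deriv_le_of_Linf_norm\<close>). Repeated integration by parts shows that the \<open>k\<close>-th Chebyshev
  coefficient of \<open>g\<close> is \<open>O(1 / (k * (k - 1) * \<dots> * (k - p)))\<close> (\<open>abs_cheb_coeff_le\<close>). The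
  coefficients are therefore absolutely summable, and the Chebyshev series of \<open>g\<close> converges to \<open>g\<close>
  (\<open>cheb_series_sums\<close>).

  Interpolation at the \<open>N + 1\<close> nodes reproduces the Chebyshev polynomials of degree at most \<open>N\<close>
  and maps each of higher degree to one of degree at most \<open>N\<close> with the same values on the
  nodes, so its error on any of them is at most 2 (\<open>abs_interp_remainder_cheb_poly_le\<close>). The
  interpolation error of \<open>g\<close> is thus at most twice the sum of the absolute coefficients beyond
  \<open>N\<close>, which is dominated by a telescoping series (\<open>falling_telescope\<close>) of order
  \<open>1 / (p * (N * (N - 1) * \<dots> * (N - p + 1)))\<close>. This is at most \<open>1 / (p * (N - p) ^ p)\<close> when \<open>N > p\<close>.

  The interpolant is a sum of \<open>N + 1\<close> products of a function of \<open>u\<close> and a function of \<open>v\<close>, so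
  the rank is at most \<open>N + 1\<close> as soon as the error is at most \<open>\<epsilon>\<close> (\<open>eps_rank_le\<close>). The choice
  \<open>N = p + n\<close>, with \<open>n\<close> the least natural number satisfying
  \<open>4 * C / pi * (h / (p * \<epsilon>)) \<le> n ^ p\<close>, achieves this.
\<close>

section \<open>Chebyshev polynomials on the unit interval\<close>

text \<open>
  The substitution \<open>x = (cos \<theta> + 1) / 2\<close> maps \<open>{0..pi}\<close> onto \<open>{0..1}\<close>; the interpolation
  nodes are the images of the multiples of \<open>pi / N\<close>.
\<close>

abbreviation cos_unit :: "real \<Rightarrow> real" where
  "cos_unit \<theta> \<equiv> (cos \<theta> + 1) / 2"

lemma cos_unit_in: "cos_unit \<theta> \<in> {0..1}"
  using cos_ge_minus_one[of \<theta>] cos_le_one[of \<theta>] by (simp del: cos_ge_minus_one cos_le_one)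

lemma cos_unit_surj:
  assumes "x \<in> {0..1}"
  obtains \<theta> where "\<theta> \<in> {0..pi}" "x = cos_unit \<theta>"
proof
  show "arccos (2 * x - 1) \<in> {0..pi}"
    using assms by (simp add: arccos_lbound arccos_ubound)
  show "x = cos_unit (arccos (2 * x - 1))"
    using assms by simp
qed

text \<open>
  The Chebyshev polynomial \<open>T\<^sub>n\<close> shifted to \<open>{0..1}\<close>, that is, \<open>x \<mapsto> T\<^sub>n(2x - 1)\<close>.
\<close>

fun cheb_poly :: "nat \<Rightarrow> real poly" where
  "cheb_poly 0 = 1"
| "cheb_poly (Suc 0) = [:- 1, 2:]"
| "cheb_poly (Suc (Suc n)) = 2 * [:- 1, 2:] * cheb_poly (Suc n) - cheb_poly n"

lemma poly_cheb_poly: "poly (cheb_poly n) (cos_unit \<theta>) = cos (real n * \<theta>)"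
proof (induction n rule: cheb_poly.induct)
  case (3 n)
  have "cos (real (Suc (Suc n)) * \<theta>) = 2 * cos \<theta> * cos (real (Suc n) * \<theta>) - cos (real n * \<theta>)"
    using cos_times_cos[of "real (Suc n) * \<theta>" \<theta>] by (simp add: algebra_simps)
  then show ?case
    using 3 by (simp add: algebra_simps)
qed (auto simp: field_simps)

lemma degree_cheb_poly: "degree (cheb_poly n) \<le> n"
proof (induction n rule: cheb_poly.induct)
  case (3 n)
  have "degree (2 * [:- 1, 2:] * cheb_poly (Suc n)) \<le> Suc (Suc n)"
    using 3(1) degree_mult_le[of "2 * [:- 1, 2:]" "cheb_poly (Suc n)"]
      degree_mult_le[of "2 :: real poly" "[:- 1, 2:]"] by simp
  moreover have "degree (cheb_poly n) \<le> Suc (Suc n)"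
    using 3(2) by simp
  ultimately show ?case
    by (simp only: cheb_poly.simps degree_diff_le)
qed auto

section \<open>Interpolation of Chebyshev polynomials\<close>

lemma lagrange_interpolation_exact:
  assumes "N \<ge> 1" "degree q \<le> N"
  shows "(\<Sum>\<alpha>=0..N. poly q (cheb_node N \<alpha>) * poly (lagrange_basis N \<alpha>) v) = poly q v"
proof -
  define r where "r = (\<Sum>\<alpha>=0..N. smult (poly q (cheb_node N \<alpha>)) (lagrange_basis N \<alpha>))"
  have inj: "inj_on (cheb_node N) {0..N}"
    using cheb_node_eq_iff[OF assms(1)] by (auto intro!: inj_onI)
  have "r = q"
  proof (rule poly_eqI_degree[where A = "cheb_node N ` {0..N}"])
    fix x assume "x \<in> cheb_node N ` {0..N}"
    then obtain \<beta> where \<beta>: "\<beta> \<le> N" "x = cheb_node N \<beta>" by auto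
    have "poly r x = (\<Sum>\<alpha>=0..N. if \<alpha> = \<beta> then poly q (cheb_node N \<alpha>) else 0)"
      unfolding r_def poly_sum \<beta>(2)
      by (intro sum.cong) (use assms(1) \<beta>(1) in \<open>auto simp: poly_lagrange_basis_node\<close>)
    then show "poly r x = poly q x"
      using \<beta> by simp
  next
    have "degree r \<le> N"
      unfolding r_def
      by (intro degree_sum_le) (use assms(1) in \<open>auto intro: order_trans[OF degree_smult_le] simp: degree_lagrange_basis\<close>)
    then show "card (cheb_node N ` {0..N}) > degree r"
      using card_image[OF inj] by simp
    show "card (cheb_node N ` {0..N}) > degree q"
      using card_image[OF inj] assms by simp
  qed
  then have "poly r v = poly q v"
    by simp
  then show ?thesis
    by (simp add: r_def poly_sum)
qed

text \<open>
  Aliasing: on the nodes, every Chebyshev polynomial agrees with one of degree at most \<open>N\<close>,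
  because \<open>\<plusminus> k\<close> may be reduced modulo \<open>2 * N\<close>.
\<close>

lemma cos_aliasing:
  assumes "N \<ge> 1"
  obtains j where "j \<le> N"
    "\<And>\<alpha>. cos (real k * (pi * real \<alpha> / real N)) = cos (real j * (pi * real \<alpha> / real N))"
proof -
  define r where "r = k mod (2 * N)"
  define q where "q = k div (2 * N)"
  have k: "real k = 2 * real N * real q + real r"
  proof -
    have "k = 2 * N * q + r"
      unfolding r_def q_def by simp
    then show ?thesis
      by (metis of_nat_add of_nat_mult of_nat_numeral)
  qed
  have r: "r < 2 * N" unfolding r_def using assms by simp
  have 1: "cos (real k * (pi * real \<alpha> / real N)) = cos (real r * (pi * real \<alpha> / real N))" for \<alpha>
  proof -
    have "real k * (pi * real \<alpha> / real N) = real r * (pi * real \<alpha> / real N) + 2 * pi * real (q * \<alpha>)"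
      using assms by (simp add: k field_simps)
    then show ?thesis
      using cos.plus_of_nat[of "real r * (pi * real \<alpha> / real N)" "q * \<alpha>"] by (simp add: mult_ac)
  qed
  show ?thesis
  proof (cases "r \<le> N")
    case True
    then show ?thesis using 1 that by blast
  next
    case False
    have "cos (real r * (pi * real \<alpha> / real N)) = cos (real (2 * N - r) * (pi * real \<alpha> / real N))" for \<alpha>
    proof -
      have "real (2 * N - r) * (pi * real \<alpha> / real N) = - (real r * (pi * real \<alpha> / real N)) + 2 * pi * real \<alpha>"
        using assms r by (simp add: of_nat_diff field_simps)
      then show ?thesis
        using cos.plus_of_nat[of "- (real r * (pi * real \<alpha> / real N))" \<alpha>] by (simp add: mult_ac)
    qed
    with False 1 show ?thesis by (intro that[of "2 * N - r"]) auto
  qed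
qed

text \<open>
  The pointwise error at \<open>v\<close> of interpolating \<open>g\<close> at the \<open>N + 1\<close> Chebyshev-Lobatto nodes.
\<close>

definition interp_remainder :: "nat \<Rightarrow> (real \<Rightarrow> real) \<Rightarrow> real \<Rightarrow> real" where
  "interp_remainder N g v = g v - (\<Sum>\<alpha>=0..N. g (cheb_node N \<alpha>) * poly (lagrange_basis N \<alpha>) v)"

lemma cheb_node_cos_unit: "cheb_node N \<alpha> = cos_unit (pi * real \<alpha> / real N)"
  by (simp add: cheb_node_def)

lemma interp_remainder_cheb_poly_eq_0:
  assumes "N \<ge> 1" "k \<le> N"
  shows "interp_remainder N (poly (cheb_poly k)) v = 0"
  using lagrange_interpolation_exact[OF assms(1), of "cheb_poly k"] degree_cheb_poly[of k] assms
  by (simp add: interp_remainder_def)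

text \<open>
  By aliasing, the interpolant of a Chebyshev polynomial is itself a Chebyshev polynomial, so the
  remainder is a difference of two functions bounded by 1. No Lebesgue constant enters.
\<close>

lemma abs_interp_remainder_cheb_poly_le:
  assumes "N \<ge> 1" "v \<in> {0..1}"
  shows "\<bar>interp_remainder N (poly (cheb_poly k)) v\<bar> \<le> 2"
proof -
  obtain \<theta> where \<theta>: "v = cos_unit \<theta>" using cos_unit_surj assms by metis
  obtain j where j: "j \<le> N"
    and al: "\<And>\<alpha>. cos (real k * (pi * real \<alpha> / real N)) = cos (real j * (pi * real \<alpha> / real N))"
    using cos_aliasing[OF assms(1)] by metis
  have "interp_remainder N (poly (cheb_poly k)) v =
      poly (cheb_poly k) v - (\<Sum>\<alpha>=0..N. poly (cheb_poly j) (cheb_node N \<alpha>) * poly (lagrange_basis N \<alpha>) v)"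
    by (simp only: interp_remainder_def cheb_node_cos_unit poly_cheb_poly al)
  also have "\<dots> = poly (cheb_poly k) v - poly (cheb_poly j) v"
    using lagrange_interpolation_exact[OF assms(1), of "cheb_poly j"] degree_cheb_poly[of j] j by simp
  also have "\<dots> = cos (real k * \<theta>) - cos (real j * \<theta>)"
    by (simp only: \<theta> poly_cheb_poly)
  also have "\<bar>\<dots>\<bar> \<le> 2"
    using abs_cos_le_one[of "real k * \<theta>"] abs_cos_le_one[of "real j * \<theta>"] by linarith
  finally show ?thesis .
qed

section \<open>Decay of Chebyshev coefficients\<close>

text \<open>
  The Chebyshev coefficients of \<open>g\<close>, normalised so that the series is
  \<open>cheb_coeff g 0 / 2 + (\<Sum>k\<ge>1. cheb_coeff g k * T\<^sub>k)\<close>.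
\<close>

definition cheb_coeff :: "(real \<Rightarrow> real) \<Rightarrow> nat \<Rightarrow> real" where
  "cheb_coeff g k = 2 / pi * integral {0..pi} (\<lambda>\<theta>. g (cos_unit \<theta>) * cos (real k * \<theta>))"

lemma continuous_on_cos_unit:
  assumes "continuous_on {0..1} g"
  shows "continuous_on {0..pi} (\<lambda>\<theta>. g (cos_unit \<theta>))"
  by (rule continuous_on_compose2[OF assms]) (use cos_unit_in in \<open>auto intro!: continuous_intros\<close>)

lemma has_integral_cheb_coeff:
  assumes "continuous_on {0..1} g"
  shows "((\<lambda>\<theta>. g (cos_unit \<theta>) * cos (real k * \<theta>)) has_integral pi / 2 * cheb_coeff g k) {0..pi}"
proof -
  have "(\<lambda>\<theta>. g (cos_unit \<theta>) * cos (real k * \<theta>)) integrable_on {0..pi}"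
    by (intro integrable_continuous_real continuous_intros continuous_on_cos_unit assms)
  then show ?thesis
    by (simp add: cheb_coeff_def has_integral_iff)
qed

text \<open>
  Integration by parts needs only that \<open>g\<close> is differentiable everywhere: the integral is a
  gauge integral, for which the derivative of any differentiable function is integrable.
\<close>

lemma cheb_coeff_by_parts:
  assumes deriv: "\<And>x. x \<in> {0..1} \<Longrightarrow> (g has_real_derivative g' x) (at x within {0..1})"
    and k: "k \<ge> 1"
  shows "((\<lambda>\<theta>. g' (cos_unit \<theta>) * sin \<theta> * sin (real k * \<theta>)) has_integral (pi * real k * cheb_coeff g k)) {0..pi}"
proof -
  have cont: "continuous_on {0..1} g"
    using deriv by (meson DERIV_continuous_on)
  \<comment> \<open>\<open>F\<close> vanishes at both ends and the integrand on the next line is its derivative.\<close>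
  define F where "F = (\<lambda>\<theta>. - 2 * g (cos_unit \<theta>) * sin (real k * \<theta>))"
  have "((\<lambda>\<theta>. g' (cos_unit \<theta>) * sin \<theta> * sin (real k * \<theta>) - 2 * real k * (g (cos_unit \<theta>) * cos (real k * \<theta>)))
      has_integral (F pi - F 0)) {0..pi}"
  proof (rule fundamental_theorem_of_calculus)
    fix \<theta> :: real assume "\<theta> \<in> {0..pi}"
    have "((\<lambda>\<theta>. g (cos_unit \<theta>)) has_real_derivative g' (cos_unit \<theta>) * (- sin \<theta> / 2)) (at \<theta> within {0..pi})"
    proof (rule DERIV_image_chain[of g _ cos_unit, unfolded o_def])
      show "(g has_real_derivative g' (cos_unit \<theta>)) (at (cos_unit \<theta>) within cos_unit ` {0..pi})"
        using cos_unit_in by (intro DERIV_subset[OF deriv[OF cos_unit_in]]) blast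
    qed (auto intro!: derivative_eq_intros)
    then show "(F has_vector_derivative g' (cos_unit \<theta>) * sin \<theta> * sin (real k * \<theta>)
          - 2 * real k * (g (cos_unit \<theta>) * cos (real k * \<theta>))) (at \<theta> within {0..pi})"
      unfolding F_def has_real_derivative_iff_has_vector_derivative[symmetric]
      by (auto intro!: derivative_eq_intros simp: field_simps)
  qed simp
  moreover have "F pi - F 0 = 0"
    by (simp add: F_def)
  moreover have "((\<lambda>\<theta>. 2 * real k * (g (cos_unit \<theta>) * cos (real k * \<theta>))) has_integral
      2 * real k * (pi / 2 * cheb_coeff g k)) {0..pi}"
    by (intro has_integral_mult_right has_integral_cheb_coeff cont)
  ultimately have "((\<lambda>\<theta>. g' (cos_unit \<theta>) * sin \<theta> * sin (real k * \<theta>) - 2 * real k * (g (cos_unit \<theta>) * cos (real k * \<theta>))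
      + 2 * real k * (g (cos_unit \<theta>) * cos (real k * \<theta>))) has_integral 0 + 2 * real k * (pi / 2 * cheb_coeff g k)) {0..pi}"
    by (intro has_integral_add) simp_all
  then show ?thesis
    by (simp add: mult_ac)
qed

text \<open>
  The coefficients of \<open>g\<close> in terms of those of its derivative, by
  \<open>2 * sin \<theta> * sin (k * \<theta>) = cos ((k - 1) * \<theta>) - cos ((k + 1) * \<theta>)\<close>.
\<close>

lemma cheb_coeff_deriv:
  assumes deriv: "\<And>x. x \<in> {0..1} \<Longrightarrow> (g has_real_derivative g' x) (at x within {0..1})"
    and cont: "continuous_on {0..1} g'" and k: "k \<ge> 1"
  shows "cheb_coeff g k = (cheb_coeff g' (k - 1) - cheb_coeff g' (k + 1)) / (4 * real k)"
proof -
  have "g' (cos_unit \<theta>) * sin \<theta> * sin (real k * \<theta>) =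
      (g' (cos_unit \<theta>) * cos (real (k - 1) * \<theta>) - g' (cos_unit \<theta>) * cos (real (k + 1) * \<theta>)) / 2" for \<theta>
  proof -
    have "sin \<theta> * sin (real k * \<theta>) = (cos (real (k - 1) * \<theta>) - cos (real (k + 1) * \<theta>)) / 2"
      using k sin_times_sin[of "real k * \<theta>" \<theta>] by (simp add: of_nat_diff algebra_simps)
    then show ?thesis
      by (simp only: mult.assoc) (simp add: right_diff_distrib)
  qed
  then have "((\<lambda>\<theta>. (g' (cos_unit \<theta>) * cos (real (k - 1) * \<theta>) - g' (cos_unit \<theta>) * cos (real (k + 1) * \<theta>)) / 2)
      has_integral (pi * real k * cheb_coeff g k)) {0..pi}"
    using cheb_coeff_by_parts[OF deriv k] by (simp only:)
  moreover have "((\<lambda>\<theta>. (g' (cos_unit \<theta>) * cos (real (k - 1) * \<theta>) - g' (cos_unit \<theta>) * cos (real (k + 1) * \<theta>)) / 2)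
      has_integral (pi / 2 * cheb_coeff g' (k - 1) - pi / 2 * cheb_coeff g' (k + 1)) / 2) {0..pi}"
    by (intro has_integral_divide has_integral_diff has_integral_cheb_coeff cont)
  ultimately have "pi * real k * cheb_coeff g k = (pi / 2 * cheb_coeff g' (k - 1) - pi / 2 * cheb_coeff g' (k + 1)) / 2"
    by (rule has_integral_unique)
  then have "pi * (4 * real k * cheb_coeff g k) = pi * (cheb_coeff g' (k - 1) - cheb_coeff g' (k + 1))"
    by (simp add: field_simps)
  then have "4 * real k * cheb_coeff g k = cheb_coeff g' (k - 1) - cheb_coeff g' (k + 1)"
    by (simp only: mult_cancel_left pi_neq_zero simp_thms)
  then show ?thesis
    using k by (simp add: field_simps)
qed

text \<open>
  The falling factorial \<open>k * (k - 1) * \<dots> * (k - p + 1)\<close> with \<open>p\<close> factors, as a real number.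
\<close>

definition falling :: "nat \<Rightarrow> nat \<Rightarrow> real" where
  "falling p k = (\<Prod>i<p. real k - real i)"

lemma falling_Suc: "falling (Suc p) k = falling p k * (real k - real p)"
  by (simp add: falling_def)

lemma falling_Suc': "falling (Suc p) (Suc k) = real (Suc k) * falling p k"
  unfolding falling_def prod.lessThan_Suc_shift by simp

lemma falling_pos: "k \<ge> p \<Longrightarrow> falling p k > 0"
  unfolding falling_def by (auto intro!: prod_pos)

lemma falling_mono: "p \<le> k \<Longrightarrow> k \<le> l \<Longrightarrow> falling p k \<le> falling p l"
  unfolding falling_def by (auto intro!: prod_mono)

lemma falling_ge_power: "p \<le> k \<Longrightarrow> (real k - real p) ^ p \<le> falling p k"
  using prod_mono[of "{..<p}" "\<lambda>_. real k - real p" "\<lambda>i. real k - real i"]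
  by (simp add: falling_def)

text \<open>
  Here \<open>D j\<close> is the \<open>j\<close>-th derivative of \<open>D 0\<close>. Each of the continuous
  derivatives \<open>D 1, \<dots>, D p\<close> gains a factor by \<open>cheb_coeff_deriv\<close>. Since \<open>D (p + 1)\<close> need not be
  continuous, the last integration by parts is estimated directly, with \<open>M * sin \<theta>\<close> as a bound of
  the integrand.
\<close>

lemma abs_cheb_coeff_le:
  assumes "\<And>j x. j \<le> p \<Longrightarrow> x \<in> {0..1} \<Longrightarrow> (D j has_real_derivative D (Suc j) x) (at x within {0..1})"
    and "\<And>x. x \<in> {0..1} \<Longrightarrow> \<bar>D (Suc p) x\<bar> \<le> M"
    and "k > p"
  shows "\<bar>cheb_coeff (D 0) k\<bar> \<le> 2 * M / (pi * falling (Suc p) k)"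
  using assms
proof (induction p arbitrary: D k)
  case 0
  let ?f = "\<lambda>\<theta>. D 1 (cos_unit \<theta>) * sin \<theta> * sin (real k * \<theta>)"
  have k: "k \<ge> 1" using 0(3) by simp
  have int: "(?f has_integral pi * real k * cheb_coeff (D 0) k) {0..pi}"
    using 0(1)[of 0] k by (intro cheb_coeff_by_parts) auto
  have int': "((\<lambda>\<theta>. M * sin \<theta>) has_integral (M * - cos pi - M * - cos 0)) {0..pi}"
    by (intro fundamental_theorem_of_calculus)
       (auto intro!: derivative_eq_intros simp flip: has_real_derivative_iff_has_vector_derivative)
  have "norm (integral {0..pi} ?f) \<le> integral {0..pi} (\<lambda>\<theta>. M * sin \<theta>)"
  proof (rule integral_norm_bound_integral)
    fix \<theta> :: real assume \<theta>: "\<theta> \<in> {0..pi}"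
    have "\<bar>D 1 (cos_unit \<theta>)\<bar> * \<bar>sin \<theta>\<bar> * \<bar>sin (real k * \<theta>)\<bar> \<le> M * \<bar>sin \<theta>\<bar> * 1"
      using 0(2)[OF cos_unit_in, of \<theta>]
      by (intro mult_mono) (auto intro: order_trans[OF abs_ge_zero])
    then show "norm (?f \<theta>) \<le> M * sin \<theta>"
      using \<theta> by (simp add: abs_mult sin_ge_zero)
  qed (use int int' in \<open>auto simp: integrable_on_def\<close>)
  then have "pi * real k * \<bar>cheb_coeff (D 0) k\<bar> \<le> 2 * M"
    using int int' by (simp add: integral_unique abs_mult)
  then show ?case
    using k by (simp add: falling_def field_simps)
next
  case (Suc p)
  have M: "M \<ge> 0" using Suc.prems(2)[of 0] by force
  obtain l where l: "k = Suc l" "l > p" using Suc.prems(3) by (cases k) auto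
  have IH: "\<bar>cheb_coeff (D 1) j\<bar> \<le> 2 * M / (pi * falling (Suc p) j)" if "j > p" for j
    using Suc.IH[of "\<lambda>j. D (Suc j)" j] Suc.prems(1,2) that by simp
  have "2 * M / (pi * falling (Suc p) (l + 2)) \<le> 2 * M / (pi * falling (Suc p) l)"
    using M l falling_pos[of "Suc p" l] falling_mono[of "Suc p" l "l + 2"]
    by (intro divide_left_mono) (auto intro!: mult_pos_pos)
  then have b: "\<bar>cheb_coeff (D 1) l - cheb_coeff (D 1) (l + 2)\<bar> \<le> 4 * M / (pi * falling (Suc p) l)"
    using IH[of l] IH[of "l + 2"] l(2) by linarith
  have "cheb_coeff (D 0) k = (cheb_coeff (D 1) (k - 1) - cheb_coeff (D 1) (k + 1)) / (4 * real k)"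
    using Suc.prems(1)[of 0] DERIV_continuous_on[OF Suc.prems(1)[of 1]] l(1) by (intro cheb_coeff_deriv) auto
  then have "\<bar>cheb_coeff (D 0) k\<bar> = \<bar>cheb_coeff (D 1) l - cheb_coeff (D 1) (l + 2)\<bar> / (4 * real k)"
    by (simp add: l(1) abs_divide)
  also have "\<dots> \<le> (4 * M / (pi * falling (Suc p) l)) / (4 * real k)"
    using b by (intro divide_right_mono) auto
  also have "\<dots> = M / (pi * (real k * falling (Suc p) l))"
    by (simp add: mult_ac)
  also have "\<dots> = M / (pi * falling (Suc (Suc p)) k)"
    using falling_Suc'[of "Suc p" l] l by simp
  also have "\<dots> \<le> 2 * M / (pi * falling (Suc (Suc p)) k)"
    using M falling_pos[of "Suc (Suc p)" k] Suc.prems(3) by (intro divide_right_mono) auto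
  finally show ?case .
qed

text \<open>
  The terms are differences of consecutive values of \<open>w j = 1 / (p * falling p (N + j))\<close>.
\<close>

lemma falling_telescope:
  assumes "p \<ge> 1" "N \<ge> p"
  shows "(\<lambda>j. 1 / falling (Suc p) (Suc (N + j))) sums (1 / (real p * falling p N))"
proof -
  define w where "w = (\<lambda>j. 1 / (real p * falling p (N + j)))"
  have eq: "1 / falling (Suc p) (Suc (N + j)) = w j - w (Suc j)" for j
  proof -
    have pos: "falling p (N + j) > 0" "falling p (Suc (N + j)) > 0" "falling (Suc p) (Suc (N + j)) > 0"
      using assms by (auto intro!: falling_pos)
    have 1: "w j = real (Suc (N + j)) / (real p * falling (Suc p) (Suc (N + j)))"
      unfolding falling_Suc' w_def using pos by simp
    have 2: "w (Suc j) = (real (Suc (N + j)) - real p) / (real p * falling (Suc p) (Suc (N + j)))"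
      unfolding falling_Suc w_def using pos assms by simp
    show ?thesis
      using assms(1) pos(3) by (simp add: 1 2 flip: diff_divide_distrib)
  qed
  have "w \<longlonglongrightarrow> 0"
  proof (rule tendsto_sandwich[of "\<lambda>_. 0" _ _ "\<lambda>j. inverse (real j)"])
    show "\<forall>\<^sub>F j in sequentially. 0 \<le> w j"
      using assms falling_pos[of p] by (intro always_eventually) (auto simp: w_def less_imp_le)
    have "w j \<le> inverse (real j)" if "j \<ge> 1" for j
    proof -
      have "real j \<le> real j ^ p"
        using that assms(1) self_le_power[of "real j" p] by simp
      also have "\<dots> \<le> (real (N + j) - real p) ^ p"
        using assms by (intro power_mono) auto
      also have "\<dots> \<le> falling p (N + j)"
        using assms by (intro falling_ge_power) simp
      also have "\<dots> \<le> real p * falling p (N + j)"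
        using assms falling_pos[of p "N + j"] by simp
      finally show ?thesis
        using that by (simp add: w_def field_simps)
    qed
    then show "\<forall>\<^sub>F j in sequentially. w j \<le> inverse (real j)"
      by (auto intro: eventually_mono[OF eventually_ge_at_top[of 1]])
  qed (auto intro: lim_inverse_n)
  then show ?thesis
    using telescope_sums'[of w 0] by (simp add: eq) (simp add: w_def)
qed

section \<open>Convergence of the Chebyshev series\<close>

text \<open>
  Completeness of the cosine system. The function \<open>d\<close> is orthogonal to all polynomials in
  \<open>cos \<theta>\<close>, and these approximate it uniformly by the theorem of Weierstrass; hence \<open>d\<close> is
  orthogonal to itself.
\<close>

lemma cosine_complete:
  fixes d :: "real \<Rightarrow> real"
  assumes cont: "continuous_on {0..pi} d"
    and orth: "\<And>k. integral {0..pi} (\<lambda>\<theta>. d \<theta> * cos (real k * \<theta>)) = 0"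
    and \<theta>: "\<theta> \<in> {0..pi}"
  shows "d \<theta> = 0"
proof -
  have pow: "((\<lambda>\<theta>. d \<theta> * cos \<theta> ^ n * cos (real k * \<theta>)) has_integral 0) {0..pi}" for n k
  proof (induction n arbitrary: k)
    case 0
    have "(\<lambda>\<theta>. d \<theta> * cos (real k * \<theta>)) integrable_on {0..pi}"
      by (intro integrable_continuous_real continuous_intros cont)
    then show ?case
      using orth[of k] by (simp add: has_integral_iff)
  next
    case (Suc n)
    \<comment> \<open>For \<open>k = 0\<close> the index \<open>k - 1\<close> stands for \<open>-1\<close>, which has the same cosine as \<open>1\<close>.\<close>
    have *: "d \<theta> * cos \<theta> ^ Suc n * cos (real k * \<theta>) =
        (d \<theta> * cos \<theta> ^ n * cos (real (k + 1) * \<theta>)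
         + d \<theta> * cos \<theta> ^ n * cos (real (if k = 0 then 1 else k - 1) * \<theta>)) / 2" for \<theta>
    proof -
      have "cos \<theta> * cos (real k * \<theta>) =
          (cos (real (k + 1) * \<theta>) + cos (real (if k = 0 then 1 else k - 1) * \<theta>)) / 2"
        using cos_times_cos[of "real k * \<theta>" \<theta>] by (cases k) (simp_all add: field_simps)
      then show ?thesis
        unfolding power_Suc2 mult.assoc by (simp only: distrib_left times_divide_eq_right)
    qed
    have "((\<lambda>\<theta>. (d \<theta> * cos \<theta> ^ n * cos (real (k + 1) * \<theta>)
         + d \<theta> * cos \<theta> ^ n * cos (real (if k = 0 then 1 else k - 1) * \<theta>)) / 2) has_integral (0 + 0) / 2) {0..pi}"
      by (intro has_integral_divide has_integral_add Suc.IH)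
    then show ?case
      unfolding * by simp
  qed
  have d_int: "(\<lambda>\<theta>. \<bar>d \<theta>\<bar>) integrable_on {0..pi}"
    by (intro integrable_continuous_real continuous_intros cont)
  have d2_int: "(\<lambda>\<theta>. d \<theta> * d \<theta>) integrable_on {0..pi}"
    by (intro integrable_continuous_real continuous_intros cont)
  define I where "I = integral {0..pi} (\<lambda>\<theta>. \<bar>d \<theta>\<bar>)"
  have bound: "integral {0..pi} (\<lambda>\<theta>. d \<theta> * d \<theta>) \<le> e * I" if "e > 0" for e
  proof -
    have "continuous_on {-1..1} (\<lambda>x. d (arccos x))"
      by (rule continuous_on_compose2[OF cont continuous_on_arccos'])
         (auto intro: arccos_lbound arccos_ubound)
    from Stone_Weierstrass_real_polynomial_function[OF compact_Icc this \<open>e > 0\<close>]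
    obtain q where q: "real_polynomial_function q" "\<And>x. x \<in> {-1..1} \<Longrightarrow> \<bar>d (arccos x) - q x\<bar> < e"
      by blast
    obtain a n where an: "q = (\<lambda>x. \<Sum>i\<le>n. a i * x ^ i)"
      using q(1) real_polynomial_function_iff_sum by blast
    have close: "\<bar>d \<theta> - q (cos \<theta>)\<bar> \<le> e" if "\<theta> \<in> {0..pi}" for \<theta>
      using q(2)[of "cos \<theta>"] that by (simp add: arccos_cos less_imp_le)
    have "((\<lambda>\<theta>. \<Sum>i\<le>n. a i * (d \<theta> * cos \<theta> ^ i * cos (real 0 * \<theta>))) has_integral (\<Sum>i\<le>n. a i * 0)) {0..pi}"
      by (intro has_integral_sum has_integral_mult_right pow) simp
    then have "((\<lambda>\<theta>. d \<theta> * q (cos \<theta>)) has_integral 0) {0..pi}"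
      by (simp add: an sum_distrib_left mult_ac)
    then have "((\<lambda>\<theta>. d \<theta> * d \<theta> - d \<theta> * q (cos \<theta>)) has_integral
        (integral {0..pi} (\<lambda>\<theta>. d \<theta> * d \<theta>) - 0)) {0..pi}"
      using d2_int by (intro has_integral_diff integrable_integral)
    moreover have "((\<lambda>\<theta>. e * \<bar>d \<theta>\<bar>) has_integral e * I) {0..pi}"
      unfolding I_def using d_int by (intro has_integral_mult_right integrable_integral)
    ultimately have "integral {0..pi} (\<lambda>\<theta>. d \<theta> * d \<theta>) - 0 \<le> e * I"
    proof (rule has_integral_le)
      fix \<theta> :: real assume "\<theta> \<in> {0..pi}"
      have "d \<theta> * d \<theta> - d \<theta> * q (cos \<theta>) = (d \<theta> - q (cos \<theta>)) * d \<theta>"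
        by (simp add: algebra_simps)
      also have "\<dots> \<le> \<bar>d \<theta> - q (cos \<theta>)\<bar> * \<bar>d \<theta>\<bar>"
        by (metis abs_ge_self abs_mult)
      also have "\<dots> \<le> e * \<bar>d \<theta>\<bar>"
        using close[OF \<open>\<theta> \<in> {0..pi}\<close>] by (intro mult_right_mono) auto
      finally show "d \<theta> * d \<theta> - d \<theta> * q (cos \<theta>) \<le> e * \<bar>d \<theta>\<bar>" .
    qed
    then show ?thesis by simp
  qed
  have "I \<ge> 0"
    unfolding I_def by (intro integral_nonneg d_int) auto
  have "integral {0..pi} (\<lambda>\<theta>. d \<theta> * d \<theta>) \<le> 0"
  proof (rule field_le_epsilon)
    fix e :: real assume "e > 0"
    then have "integral {0..pi} (\<lambda>\<theta>. d \<theta> * d \<theta>) \<le> e / (I + 1) * I"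
      using \<open>I \<ge> 0\<close> by (intro bound) auto
    also have "\<dots> \<le> e"
      using \<open>I \<ge> 0\<close> \<open>e > 0\<close> by (simp add: field_simps)
    finally show "integral {0..pi} (\<lambda>\<theta>. d \<theta> * d \<theta>) \<le> 0 + e" by simp
  qed
  moreover have "integral {0..pi} (\<lambda>\<theta>. d \<theta> * d \<theta>) \<ge> 0"
    by (intro integral_nonneg d2_int) auto
  ultimately have "((\<lambda>\<theta>. d \<theta> * d \<theta>) has_integral 0) (cbox 0 pi)"
    using d2_int by (simp add: has_integral_iff)
  then have "d \<theta> * d \<theta> = 0"
    using \<theta> by (intro has_integral_0_cbox_imp_0[of 0 pi "\<lambda>\<theta>. d \<theta> * d \<theta>"])
      (auto intro!: continuous_intros cont simp: not_le)
  then show ?thesis by simp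
qed

lemma integral_cos_cos:
  "((\<lambda>\<theta>. cos (real j * \<theta>) * cos (real k * \<theta>)) has_integral
     (if j = k then if k = 0 then pi else pi / 2 else 0)) {0..pi}"
proof -
  have c: "((\<lambda>\<theta>. cos (real_of_int n * \<theta>)) has_integral (if n = 0 then pi else 0)) {0..pi}" for n
  proof (cases "n = 0")
    case True
    then show ?thesis
      using has_integral_const_real[of "1::real" 0 pi] by simp
  next
    case False
    have "((\<lambda>\<theta>. cos (real_of_int n * \<theta>)) has_integral
        (sin (real_of_int n * pi) / real_of_int n - sin (real_of_int n * 0) / real_of_int n)) {0..pi}"
      by (intro fundamental_theorem_of_calculus)
         (use False in \<open>auto intro!: derivative_eq_intros simp flip: has_real_derivative_iff_has_vector_derivative\<close>)
    then show ?thesis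
      using False sin_npi_int[of n] by (simp add: mult.commute[of _ pi])
  qed
  have "((\<lambda>\<theta>. (cos (real_of_int (int j - int k) * \<theta>) + cos (real_of_int (int j + int k) * \<theta>)) / 2) has_integral
      ((if int j - int k = 0 then pi else 0) + (if int j + int k = 0 then pi else 0)) / 2) {0..pi}"
    by (intro has_integral_divide has_integral_add c)
  moreover have "(cos (real_of_int (int j - int k) * \<theta>) + cos (real_of_int (int j + int k) * \<theta>)) / 2
      = cos (real j * \<theta>) * cos (real k * \<theta>)" for \<theta>
    by (simp add: cos_times_cos algebra_simps)
  moreover have "((if int j - int k = 0 then pi else 0) + (if int j + int k = 0 then pi else 0)) / 2
      = (if j = k then if k = 0 then pi else pi / 2 else 0)"
    by auto
  ultimately show ?thesis
    by (simp only:)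
qed

text \<open>
  The factor with which \<open>T\<^sub>k\<close> occurs in the Chebyshev series: the constant term is halved.
\<close>

definition cheb_series_coeff :: "(real \<Rightarrow> real) \<Rightarrow> nat \<Rightarrow> real" where
  "cheb_series_coeff g k = (if k = 0 then 1 / 2 else 1) * cheb_coeff g k"

text \<open>
  If the coefficients are absolutely summable, the series converges uniformly to a continuous
  function with the same coefficients as \<open>g\<close>, which is \<open>g\<close> by completeness.
\<close>

lemma cheb_series_sums:
  assumes cont: "continuous_on {0..1} g"
    and summ: "summable (\<lambda>k. \<bar>cheb_coeff g k\<bar>)"
    and x: "x \<in> {0..1}"
  shows "(\<lambda>k. cheb_series_coeff g k * poly (cheb_poly k) x) sums g x"
proof -
  define b where "b = cheb_series_coeff g"
  define t where "t = (\<lambda>k \<theta>. b k * cos (real k * \<theta>))"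
  define S where "S = (\<lambda>\<theta>. \<Sum>k. t k \<theta>)"
  have t_le: "norm (t k \<theta>) \<le> \<bar>cheb_coeff g k\<bar>" for k \<theta>
  proof -
    have "\<bar>b k\<bar> * \<bar>cos (real k * \<theta>)\<bar> \<le> \<bar>cheb_coeff g k\<bar> * 1"
      by (intro mult_mono) (auto simp: b_def cheb_series_coeff_def)
    then show ?thesis by (simp add: t_def abs_mult)
  qed
  have unif: "uniform_limit {0..pi} (\<lambda>n \<theta>. \<Sum>k<n. t k \<theta>) S sequentially"
    unfolding S_def by (rule Weierstrass_m_test[OF t_le summ])
  have contS: "continuous_on {0..pi} S"
    by (rule uniform_limit_theorem[OF _ unif]) (auto intro!: always_eventually continuous_intros simp: t_def)
  have orth: "integral {0..pi} (\<lambda>\<theta>. (g (cos_unit \<theta>) - S \<theta>) * cos (real k * \<theta>)) = 0" for k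
  proof -
    have "uniform_limit {0..pi} (\<lambda>n \<theta>. (\<Sum>j<n. t j \<theta>) * cos (real k * \<theta>)) (\<lambda>\<theta>. S \<theta> * cos (real k * \<theta>)) sequentially"
      by (intro uniform_lim_mult unif uniform_limit_const compact_imp_bounded compact_continuous_image
          continuous_intros contS) auto
    then obtain I J where IJ: "\<And>n. ((\<lambda>\<theta>. (\<Sum>j<n. t j \<theta>) * cos (real k * \<theta>)) has_integral I n) {0..pi}"
        "((\<lambda>\<theta>. S \<theta> * cos (real k * \<theta>)) has_integral J) {0..pi}" "I \<longlonglongrightarrow> J"
      by (rule uniform_limit_integral) (auto intro!: continuous_intros simp: t_def)
    have "I n = pi / 2 * cheb_coeff g k" if "n > k" for n
    proof (rule has_integral_unique[OF IJ(1)])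
      have "((\<lambda>\<theta>. \<Sum>j<n. b j * (cos (real j * \<theta>) * cos (real k * \<theta>))) has_integral
          (\<Sum>j<n. b j * (if j = k then if k = 0 then pi else pi / 2 else 0))) {0..pi}"
        by (intro has_integral_sum has_integral_mult_right integral_cos_cos) simp
      moreover have "(\<Sum>j<n. b j * (if j = k then if k = 0 then pi else pi / 2 else 0)) = pi / 2 * cheb_coeff g k"
      proof -
        have "(\<Sum>j<n. b j * (if j = k then if k = 0 then pi else pi / 2 else 0)) =
            (\<Sum>j<n. if j = k then pi / 2 * cheb_coeff g k else 0)"
          by (intro sum.cong) (auto simp: b_def cheb_series_coeff_def)
        then show ?thesis
          using that by simp
      qed
      ultimately show "((\<lambda>\<theta>. (\<Sum>j<n. t j \<theta>) * cos (real k * \<theta>)) has_integral pi / 2 * cheb_coeff g k) {0..pi}"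
        by (simp add: t_def sum_distrib_right mult.assoc)
    qed
    then have "I \<longlonglongrightarrow> pi / 2 * cheb_coeff g k"
      by (intro tendsto_eventually) (auto intro: eventually_mono[OF eventually_gt_at_top[of k]])
    then have J: "J = pi / 2 * cheb_coeff g k"
      using IJ(3) LIMSEQ_unique by blast
    have "((\<lambda>\<theta>. g (cos_unit \<theta>) * cos (real k * \<theta>) - S \<theta> * cos (real k * \<theta>)) has_integral
        (pi / 2 * cheb_coeff g k - J)) {0..pi}"
      by (intro has_integral_diff has_integral_cheb_coeff cont IJ(2))
    then show ?thesis
      by (simp add: J integral_unique left_diff_distrib)
  qed
  obtain \<theta> where \<theta>: "\<theta> \<in> {0..pi}" "x = cos_unit \<theta>"
    using cos_unit_surj[OF x] by blast
  have "g (cos_unit \<theta>) - S \<theta> = 0"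
    by (rule cosine_complete[where d = "\<lambda>\<theta>. g (cos_unit \<theta>) - S \<theta>"])
       (intro continuous_intros continuous_on_cos_unit cont contS, rule orth, rule \<theta>(1))
  moreover have "(\<lambda>k. t k \<theta>) sums S \<theta>"
    unfolding S_def by (intro summable_sums summable_comparison_test'[OF summ] t_le)
  ultimately show ?thesis
    unfolding \<theta>(2) poly_cheb_poly by (simp add: t_def b_def)
qed

section \<open>Interpolation error\<close>

text \<open>
  Expanding \<open>D 0\<close> in its Chebyshev series, the terms of degree at most \<open>N\<close> are interpolated
  exactly and every other one contributes at most twice its coefficient. The case \<open>N = p\<close> is
  included, since \<open>falling p p\<close> is positive.
\<close>

lemma abs_interp_remainder_le:
  assumes deriv: "\<And>j x. j \<le> p \<Longrightarrow> x \<in> {0..1} \<Longrightarrow> (D j has_real_derivative D (Suc j) x) (at x within {0..1})"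
    and bound: "\<And>x. x \<in> {0..1} \<Longrightarrow> \<bar>D (Suc p) x\<bar> \<le> M"
    and p: "p \<ge> 1" "N \<ge> p" and v: "v \<in> {0..1}"
  shows "\<bar>interp_remainder N (D 0) v\<bar> \<le> 4 * M / (pi * (real p * falling p N))"
proof -
  let ?b = "cheb_series_coeff (D 0)"
  have cont: "continuous_on {0..1} (D 0)"
    using DERIV_continuous_on[OF deriv[of 0]] by auto
  have coeff: "\<bar>cheb_coeff (D 0) (Suc (N + j))\<bar> \<le> 2 * M / pi * (1 / falling (Suc p) (Suc (N + j)))" for j
    using abs_cheb_coeff_le[OF deriv bound, of "Suc (N + j)"] p by simp
  have "summable (\<lambda>j. \<bar>cheb_coeff (D 0) (j + Suc N)\<bar>)"
    by (rule summable_comparison_test'[OF summable_mult[OF sums_summable[OF falling_telescope[OF p]], of "2 * M / pi"]])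
       (use coeff in \<open>simp add: add_ac\<close>)
  then have summ: "summable (\<lambda>j. \<bar>cheb_coeff (D 0) j\<bar>)"
    using summable_iff_shift[of "\<lambda>j. \<bar>cheb_coeff (D 0) j\<bar>" "Suc N"] by simp
  note series = cheb_series_sums[OF cont summ]
  have node: "cheb_node N \<alpha> \<in> {0..1}" for \<alpha>
    unfolding cheb_node_cos_unit by (rule cos_unit_in)
  let ?r = "\<lambda>k. ?b k * interp_remainder N (poly (cheb_poly k)) v"
  have "(\<lambda>k. ?b k * poly (cheb_poly k) v -
      (\<Sum>\<alpha>=0..N. ?b k * poly (cheb_poly k) (cheb_node N \<alpha>) * poly (lagrange_basis N \<alpha>) v))
      sums interp_remainder N (D 0) v"
    unfolding interp_remainder_def
    by (intro sums_diff sums_sum sums_mult2 series v node)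
  then have "?r sums interp_remainder N (D 0) v"
    by (simp add: interp_remainder_def right_diff_distrib sum_distrib_left mult_ac)
  moreover have "(\<Sum>k<Suc N. ?r k) = 0"
    using p by (intro sum.neutral) (auto simp: interp_remainder_cheb_poly_eq_0)
  ultimately have *: "(\<lambda>j. ?r (j + Suc N)) sums interp_remainder N (D 0) v"
    using sums_iff_shift[of ?r "Suc N" "interp_remainder N (D 0) v"] by simp
  have le: "norm (?r (j + Suc N)) \<le> 4 * M / pi * (1 / falling (Suc p) (Suc (N + j)))" for j
  proof -
    have "\<bar>?b (Suc (N + j))\<bar> * \<bar>interp_remainder N (poly (cheb_poly (Suc (N + j)))) v\<bar>
        \<le> (2 * M / pi * (1 / falling (Suc p) (Suc (N + j)))) * 2"
      using coeff[of j] p v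
      by (intro mult_mono abs_interp_remainder_cheb_poly_le order_trans[OF abs_ge_zero coeff])
         (auto simp: cheb_series_coeff_def)
    then show ?thesis
      by (simp add: abs_mult add_ac)
  qed
  have "norm (\<Sum>j. ?r (j + Suc N)) \<le> (\<Sum>j. 4 * M / pi * (1 / falling (Suc p) (Suc (N + j))))"
    by (rule norm_suminf_le[OF le]) (intro summable_mult sums_summable[OF falling_telescope[OF p]])
  also have "\<dots> = 4 * M / pi * (1 / (real p * falling p N))"
    using sums_mult[OF falling_telescope[OF p], of "4 * M / pi"] by (simp add: sums_iff)
  finally show ?thesis
    using * by (simp add: sums_iff)
qed

lemma unit_deriv_has_derivative:
  assumes "times_differentiable n f" "j < n" "x \<in> {0..1}"
  shows "(unit_deriv j f has_real_derivative unit_deriv (Suc j) f x) (at x within {0..1})"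
proof -
  have "unit_deriv j f differentiable (at x within {0..1})"
    using assms by (auto simp: times_differentiable_def differentiable_on_def)
  then show ?thesis
    by (simp add: vector_derivative_works has_real_derivative_iff_has_vector_derivative)
qed

text \<open>
  For the derivative of an everywhere differentiable function, an essential bound is a bound at
  every point: by the fundamental theorem for the gauge integral the function is Lipschitz with
  constant \<open>C\<close>.
\<close>

lemma abs_deriv_le_of_Linf_norm:
  assumes deriv: "\<And>x. x \<in> {0..1} \<Longrightarrow> (F has_real_derivative F' x) (at x within {0..1})"
    and Linf: "Linf_norm F' \<le> ereal C"
    and x: "x \<in> {0..1}"
  shows "\<bar>F' x\<bar> \<le> C"
proof -
  have "AE x in lebesgue_on {0..1}. ereal \<bar>F' x\<bar> \<le> ereal C"
    using esssup_AE[of "\<lambda>x. ereal \<bar>F' x\<bar>" "lebesgue_on {0..1}"] Linf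
    unfolding Linf_norm_def by (elim eventually_mono) (rule order_trans)
  then have "AE x in lebesgue. x \<in> {0..1} \<longrightarrow> \<bar>F' x\<bar> \<le> C"
    by (subst (asm) AE_restrict_space_iff) auto
  then obtain S where S: "negligible S" "\<And>x. x \<in> {0..1} - S \<Longrightarrow> \<bar>F' x\<bar> \<le> C"
    by (auto elim!: AE_E simp: completion.AE_iff_null_sets negligible_iff_null_sets)
  have "\<not> {0..1::real} \<subseteq> S"
    using negligible_subset[OF S(1)] negligible_interval(1)[of 0 "1::real"] by auto
  then obtain x0 where "x0 \<in> {0..1} - S" by blast
  then have C: "C \<ge> 0" using S(2) by force
  have lip: "\<bar>F b - F a\<bar> \<le> C * (b - a)" if ab: "0 \<le> a" "a \<le> b" "b \<le> 1" for a b
  proof -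
    have "(F' has_integral (F b - F a)) {a..b}"
      using ab by (intro fundamental_theorem_of_calculus)
        (auto simp flip: has_real_derivative_iff_has_vector_derivative intro!: DERIV_subset[OF deriv])
    then have "((\<lambda>x. if x \<in> S then 0 else F' x) has_integral (F b - F a)) {a..b}"
      by (rule has_integral_spike[OF S(1), rotated]) auto
    then have "norm (F b - F a) \<le> C * measure lborel {a..b}"
      by (rule has_integral_bound_real[OF C finite.emptyI]) (use S(2) C ab in auto)
    then show ?thesis using ab by simp
  qed
  have "((\<lambda>y. \<bar>(F y - F x) / (y - x)\<bar>) \<longlongrightarrow> \<bar>F' x\<bar>) (at x within {0..1})"
    using deriv[OF x] unfolding has_field_derivative_iff by (rule tendsto_rabs)
  moreover have "\<bar>(F y - F x) / (y - x)\<bar> \<le> C" if "y \<in> {0..1}" "y \<noteq> x" for y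
    using lip[of x y] lip[of y x] that x by (cases "x \<le> y") (auto simp: abs_divide divide_simps abs_minus_commute)
  then have "\<forall>\<^sub>F y in at x within {0..1}. \<bar>(F y - F x) / (y - x)\<bar> \<le> C"
    by (auto simp: eventually_at_filter)
  moreover have "at x within {0..1} \<noteq> bot"
    using x by (simp add: trivial_limit_within islimpt_Icc)
  ultimately show ?thesis
    by (intro tendsto_upperbound) auto
qed

text \<open>
  On an interval of length \<open>h\<close>, the rescaled derivative of order \<open>p + 1\<close> is bounded by
  \<open>h ^ (p + 1) * C\<close>, of which only \<open>h * C\<close> is retained.
\<close>

lemma interp_remainder_rescaled_le:
  assumes p: "p \<ge> 1" "N \<ge> p" and diff: "times_differentiable (p + 1) f"
    and Linf: "Linf_norm (unit_deriv (p + 1) f) \<le> ereal C"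
    and h: "0 \<le> h" "h \<le> 1" and u: "u \<in> {0..1 - h}" and v: "v \<in> {0..1}"
  shows "\<bar>interp_remainder N (\<lambda>v. f (u + h * v)) v\<bar> \<le> 4 * C / pi * (h / (real p * falling p N))"
proof -
  have sub: "u + h * x \<in> {0..1}" if "x \<in> {0..1}" for x
    using that u h mult_left_le[of x h] by auto
  have bound: "\<bar>unit_deriv (Suc p) f y\<bar> \<le> C" if "y \<in> {0..1}" for y
    using that Linf by (intro abs_deriv_le_of_Linf_norm[OF unit_deriv_has_derivative[OF diff]]) auto
  then have C: "C \<ge> 0" by force
  define D where "D = (\<lambda>j x. h ^ j * unit_deriv j f (u + h * x))"
  have deriv: "(D j has_real_derivative D (Suc j) x) (at x within {0..1})" if "j \<le> p" "x \<in> {0..1}" for j x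
  proof -
    have "((\<lambda>x. unit_deriv j f (u + h * x)) has_real_derivative unit_deriv (Suc j) f (u + h * x) * h) (at x within {0..1})"
    proof (rule DERIV_image_chain[of "unit_deriv j f" _ "\<lambda>x. u + h * x", unfolded o_def])
      show "(unit_deriv j f has_real_derivative unit_deriv (Suc j) f (u + h * x))
          (at (u + h * x) within (\<lambda>x. u + h * x) ` {0..1})"
      proof (rule DERIV_subset)
        show "(unit_deriv j f has_real_derivative unit_deriv (Suc j) f (u + h * x)) (at (u + h * x) within {0..1})"
          using that by (intro unit_deriv_has_derivative[OF diff] sub) auto
        show "(\<lambda>x. u + h * x) ` {0..1} \<subseteq> {0..1}"
          using sub by blast
      qed
    qed (auto intro!: derivative_eq_intros)
    then show ?thesis
      unfolding D_def by (auto intro!: derivative_eq_intros simp: mult_ac)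
  qed
  have M: "\<bar>D (Suc p) x\<bar> \<le> h * C" if "x \<in> {0..1}" for x
  proof -
    have "h * h ^ p * \<bar>unit_deriv (Suc p) f (u + h * x)\<bar> \<le> h * 1 * C"
      using h C bound[OF sub[OF that]] by (intro mult_mono power_le_one) auto
    then show ?thesis
      using h by (simp add: D_def abs_mult)
  qed
  have "D 0 = (\<lambda>v. f (u + h * v))" by (simp add: D_def)
  then show ?thesis
    using abs_interp_remainder_le[OF deriv M p v] by (simp add: mult_ac)
qed

section \<open>Rank of the unfolding matrix\<close>

text \<open>
  The first \<open>m\<close> bits determine \<open>u\<close> and the others \<open>v\<close>; the interpolant of
  \<open>v \<mapsto> f (u + v / 2 ^ m)\<close> is then a sum of \<open>N + 1\<close> elementary tensors.
\<close>

lemma eps_rank_le: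
  assumes "K > m"
    and approx: "\<And>u v. u \<in> {0..1 - 1 / 2 ^ m} \<Longrightarrow> v \<in> {0..1} \<Longrightarrow>
      \<bar>interp_remainder N (\<lambda>v. f (u + 1 / 2 ^ m * v)) v\<bar> \<le> \<epsilon>"
  shows "eps_rank K m \<epsilon> (quantized_tensor K f) \<le> Suc N"
proof -
  \<comment> \<open>\<open>val n \<sigma>\<close> is the number in the unit interval whose first \<open>n\<close> binary digits are \<open>\<sigma>\<close>.\<close>
  define val :: "nat \<Rightarrow> nat list \<Rightarrow> real" where "val = (\<lambda>n \<sigma>. \<Sum>k=1..n. 1 / 2 ^ k * real (\<sigma> ! (k - 1)))"
  define TL where "TL = (\<lambda>\<alpha> \<sigma>. f (val m \<sigma> + 1 / 2 ^ m * cheb_node N \<alpha>))"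
  define TR where "TR = (\<lambda>\<alpha> \<sigma>. poly (lagrange_basis N \<alpha>) (val (K - m) \<sigma>))"
  have geo: "(\<Sum>k=1..n. 1 / 2 ^ k * (1::real)) = 1 - 1 / 2 ^ n" for n :: nat
    by (induction n) (auto simp: field_simps)
  have val_range: "val n \<sigma> \<in> {0..1 - 1 / 2 ^ n}" if "\<sigma> \<in> bits n" for n \<sigma>
  proof -
    have "real (\<sigma> ! (k - 1)) \<le> 1" if "k \<in> {1..n}" for k
    proof -
      have "\<sigma> ! (k - 1) \<in> set \<sigma>"
        using that \<open>\<sigma> \<in> bits n\<close> by (intro nth_mem) (auto simp: bits_def)
      then show ?thesis
        using \<open>\<sigma> \<in> bits n\<close> by (auto simp: bits_def)
    qed
    then have "val n \<sigma> \<le> (\<Sum>k=1..n. 1 / 2 ^ k * (1::real))"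
      unfolding val_def by (intro sum_mono mult_left_mono) auto
    then show ?thesis
      unfolding geo by (auto simp: val_def intro!: sum_nonneg)
  qed
  have split: "val K \<sigma> = val m (take m \<sigma>) + 1 / 2 ^ m * val (K - m) (drop m \<sigma>)" if "\<sigma> \<in> bits K" for \<sigma>
  proof -
    have len: "length \<sigma> = K" using that by (simp add: bits_def)
    have "val K \<sigma> = (\<Sum>k=1..m. 1 / 2 ^ k * real (\<sigma> ! (k - 1))) + (\<Sum>k=m+1..K. 1 / 2 ^ k * real (\<sigma> ! (k - 1)))"
      unfolding val_def using assms(1) sum.ub_add_nat[of 1 m _ "K - m"] by simp
    also have "(\<Sum>k=1..m. 1 / 2 ^ k * real (\<sigma> ! (k - 1))) = val m (take m \<sigma>)"
      unfolding val_def by (intro sum.cong) auto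
    also have "(\<Sum>k=m+1..K. 1 / 2 ^ k * real (\<sigma> ! (k - 1))) = (\<Sum>k=1..K-m. 1 / 2 ^ (k + m) * real (\<sigma> ! (k + m - 1)))"
      using assms(1) sum.shift_bounds_cl_nat_ivl[of _ 1 m "K - m"] by (simp add: add_ac)
    also have "\<dots> = 1 / 2 ^ m * val (K - m) (drop m \<sigma>)"
      unfolding val_def sum_distrib_left
      using len assms(1) by (intro sum.cong) (auto simp: power_add add_ac)
    finally show ?thesis .
  qed
  have "tensor_norm K (\<lambda>\<sigma>. quantized_tensor K f \<sigma> - (\<Sum>\<alpha><Suc N. tensor_prod m (TL \<alpha>) (TR \<alpha>) \<sigma>)) \<le> \<epsilon>"
    unfolding tensor_norm_def
  proof (subst Max_le_iff; (intro ballI)?)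
    fix y assume "y \<in> (\<lambda>\<sigma>. \<bar>quantized_tensor K f \<sigma> - (\<Sum>\<alpha><Suc N. tensor_prod m (TL \<alpha>) (TR \<alpha>) \<sigma>)\<bar>) ` bits K"
    then obtain \<sigma> where \<sigma>: "\<sigma> \<in> bits K"
      and y: "y = \<bar>quantized_tensor K f \<sigma> - (\<Sum>\<alpha><Suc N. tensor_prod m (TL \<alpha>) (TR \<alpha>) \<sigma>)\<bar>" by blast
    define u v where "u = val m (take m \<sigma>)" and "v = val (K - m) (drop m \<sigma>)"
    have "take m \<sigma> \<in> bits m" "drop m \<sigma> \<in> bits (K - m)"
      using \<sigma> assms(1) set_take_subset[of m \<sigma>] set_drop_subset[of m \<sigma>] by (auto simp: bits_def)
    then have uv: "u \<in> {0..1 - 1 / 2 ^ m}" "v \<in> {0..1 - 1 / 2 ^ (K - m)}"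
      unfolding u_def v_def by (auto intro: val_range simp del: atLeastAtMost_iff)
    moreover have "(0::real) \<le> 1 / 2 ^ (K - m)" by simp
    ultimately have v: "v \<in> {0..1}" unfolding atLeastAtMost_iff by linarith
    have "quantized_tensor K f \<sigma> = f (u + 1 / 2 ^ m * v)"
      using split[OF \<sigma>] by (simp add: quantized_tensor_def u_def v_def val_def)
    then have "y = \<bar>interp_remainder N (\<lambda>v. f (u + 1 / 2 ^ m * v)) v\<bar>"
      by (simp add: y interp_remainder_def tensor_prod_def TL_def TR_def u_def v_def
          atLeast0AtMost lessThan_Suc_atMost del: sum.lessThan_Suc)
    then show "y \<le> \<epsilon>"
      using approx[OF uv(1) v] by simp
  qed (auto simp: finite_bits bits_nonempty)
  then show ?thesis
    unfolding eps_rank_def by (intro Least_le) blast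
qed

theorem proposition2:
  fixes f :: "real \<Rightarrow> real" and C :: real and p m :: nat
  assumes "p \<ge> 1"
    and "times_differentiable (p + 1) f"
    and "Linf_norm (unit_deriv (p + 1) f) \<le> ereal C"
    and "m \<ge> 1"
  shows "(\<forall>N::nat. N > p \<longrightarrow>
            interp_error m N f
              \<le> 4 * C / pi * ((1 / 2 ^ m) / (real p * (real N - real p) ^ p)))
       \<and> (\<forall>K::nat. K > m \<longrightarrow> (\<forall>\<epsilon>::real. \<epsilon> > 0 \<longrightarrow>
            int (eps_rank K m \<epsilon> (quantized_tensor K f))
              \<le> 1 + int p
                + \<lceil>(4 * C / pi * ((1 / 2 ^ m) / (real p * \<epsilon>))) powr (1 / real p)\<rceil>))"
proof -
  have C: "C \<ge> 0"
    using abs_deriv_le_of_Linf_norm[OF unit_deriv_has_derivative[OF assms(2), of p], of C 0] assms(3)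
    by auto
  let ?h = "1 / 2 ^ m :: real"
  have rem: "\<bar>interp_remainder N (\<lambda>v. f (u + ?h * v)) v\<bar> \<le> 4 * C / pi * (?h / (real p * falling p N))"
    if "N \<ge> p" "u \<in> {0..1 - ?h}" "v \<in> {0..1}" for N u v
    using interp_remainder_rescaled_le[OF assms(1) that(1) assms(2,3) _ _ that(2,3)] by simp
  have rem': "\<bar>interp_remainder N (\<lambda>v. f (u + ?h * v)) v\<bar> \<le> 4 * C / pi * (?h / (real p * (real N - real p) ^ p))"
    if "N > p" "u \<in> {0..1 - ?h}" "v \<in> {0..1}" for N u v
  proof -
    have "4 * C / pi * (?h / (real p * falling p N)) \<le> 4 * C / pi * (?h / (real p * (real N - real p) ^ p))"
      using C assms(1) that(1) falling_ge_power[of p N] falling_pos[of p N]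
      by (intro mult_left_mono divide_left_mono mult_pos_pos) auto
    with rem[of N u v] that show ?thesis by simp
  qed
  show ?thesis
  proof (intro conjI allI impI)
    fix N :: nat assume "N > p"
    then show "interp_error m N f \<le> 4 * C / pi * (?h / (real p * (real N - real p) ^ p))"
      unfolding interp_error_def
      by (intro cSUP_least) (use rem'[of N] in \<open>auto simp: interp_remainder_def\<close>)
  next
    fix K :: nat and \<epsilon> :: real assume K: "K > m" and \<epsilon>: "\<epsilon> > 0"
    define A where "A = 4 * C / pi * (?h / (real p * \<epsilon>))"
    define n where "n = nat \<lceil>A powr (1 / real p)\<rceil>"
    have n: "int n = \<lceil>A powr (1 / real p)\<rceil>"
      unfolding n_def by (intro int_nat_eq[THEN trans] if_P) (simp add: le_ceiling_iff less_le_trans[OF _ powr_ge_zero])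
    have "\<bar>interp_remainder (p + n) (\<lambda>v. f (u + ?h * v)) v\<bar> \<le> \<epsilon>"
      if uv: "u \<in> {0..1 - ?h}" "v \<in> {0..1}" for u v
    \<comment> \<open>For \<open>C = 0\<close> the ceiling is 0, so that \<open>N = p\<close> and the bound with \<open>falling\<close> is needed.\<close>
    proof (cases "C = 0")
      case True
      then show ?thesis
        using rem[of "p + n", OF _ uv] \<epsilon> by simp
    next
      case False
      then have A: "A > 0"
        using C \<epsilon> assms(1) by (simp add: A_def)
      then have "n > 0"
        unfolding n_def by simp
      have "A = (A powr (1 / real p)) powr real p"
        using A assms(1) by (simp add: powr_powr)
      also have "\<dots> \<le> real n powr real p"
        by (intro powr_mono2) (auto simp: n_def)
      also have "\<dots> = real n ^ p"
        using \<open>n > 0\<close> by (simp add: powr_realpow)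
      finally have "4 * C / pi * (?h / (real p * real n ^ p)) \<le> \<epsilon>"
        using \<epsilon> \<open>n > 0\<close> assms(1) by (simp add: A_def field_simps)
      then show ?thesis
        using rem'[of "p + n", OF _ uv] \<open>n > 0\<close> by simp
    qed
    then have "eps_rank K m \<epsilon> (quantized_tensor K f) \<le> Suc (p + n)"
      using K by (intro eps_rank_le)
    then show "int (eps_rank K m \<epsilon> (quantized_tensor K f)) \<le> 1 + int p + \<lceil>A powr (1 / real p)\<rceil>"
      unfolding n[symmetric] by simp
  qed
qed

end
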